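(* For every integer $t \geq 1$, $$s_{3,t}(m) \ll s_{3,t+1}(m+1) \ll m\, s_{3,t}(m).$$
   Context: All graphs are finite and simple. A $(3,t)$-system is a pair $(H,\mathcal{F})$ where $H$ is a triangle-free graph and $\mathcal{F}$ is a family (without repeated elements) of subsets of $V(H)$, each of size exactly $t$, such that every $S\in\mathcal{F}$ is a maximal independent set of $H$ (independent, and every vertex outside $S$ has a neighbour in $S$), and any two distinct sets in $\mathcal{F}$ intersect. For integers $t\ge1$, $m\ge0$, $s_{3,t}(m)$ is the maximum of $|\mathcal{F}|$ over all $(3,t)$-systems $(H,\mathcal{F})$ with $|V(H)|=m$. $f\ll g$ means $f=O(g)$ as $m\to\infty$ with $t$ fixed (constants may depend on $t$). *)

theory Defs
  imports "HOL-Library.Ramsey" "HOL-Library.Landau_Symbols"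
begin

text \<open>
  A graph is given by its vertex set \<open>V\<close> and a set \<open>E\<close> of two-element subsets of \<open>V\<close>;
  \<^const>\<open>clique\<close> and \<^const>\<open>indep\<close> are the notions from \<^theory>\<open>HOL-Library.Ramsey\<close>.
\<close>

definition fin_sgraph :: "'a set \<Rightarrow> 'a set set \<Rightarrow> bool" where
  "fin_sgraph V E \<longleftrightarrow> finite V \<and> E \<subseteq> [V]\<^bsup>2\<^esup>"

definition triangle_free :: "'a set \<Rightarrow> 'a set set \<Rightarrow> bool" where
  "triangle_free V E \<longleftrightarrow> (\<forall>T \<in> [V]\<^bsup>3\<^esup>. \<not> clique T E)"

definition maximal_indep :: "'a set \<Rightarrow> 'a set set \<Rightarrow> 'a set \<Rightarrow> bool" where
  "maximal_indep V E S \<longleftrightarrow>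
     S \<subseteq> V \<and> indep S E \<and> (\<forall>v \<in> V - S. \<exists>u \<in> S. {u, v} \<in> E)"

definition system3 :: "nat \<Rightarrow> 'a set \<Rightarrow> 'a set set \<Rightarrow> 'a set set \<Rightarrow> bool" where
  "system3 t V E \<F> \<longleftrightarrow>
     fin_sgraph V E \<and> triangle_free V E \<and>
     (\<forall>S \<in> \<F>. card S = t \<and> maximal_indep V E S) \<and>
     (\<forall>S \<in> \<F>. \<forall>T \<in> \<F>. S \<noteq> T \<longrightarrow> S \<inter> T \<noteq> {})"

text \<open>
  Vertices are taken to be natural numbers, which loses no generality for finite graphs:
  lemma \<open>card_le_s3\<close> below bounds systems over an arbitrary vertex type.
\<close>

definition s3 :: "nat \<Rightarrow> nat \<Rightarrow> nat" where
  "s3 t m = Max {card \<F> | (V :: nat set) E \<F>. system3 t V E \<F> \<and> card V = m}"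

lemma system3_subset_Pow: "system3 t V E \<F> \<Longrightarrow> \<F> \<subseteq> Pow V"
  by (auto simp: system3_def maximal_indep_def)

lemma finite_s3_set: "finite {card \<F> | (V :: nat set) E \<F>. system3 t V E \<F> \<and> card V = m}"
proof (rule finite_subset)
  show "{card \<F> | (V :: nat set) E \<F>. system3 t V E \<F> \<and> card V = m} \<subseteq> {..2 ^ m}"
  proof safe
    fix V :: "nat set" and E \<F>
    assume s: "system3 t V E \<F>"
    then have "finite V" by (simp add: system3_def fin_sgraph_def)
    then show "card \<F> \<le> 2 ^ card V"
      using card_mono[OF _ system3_subset_Pow[OF s]] by (simp add: card_Pow)
  qed
qed simp

lemma card_in_s3_set:
  fixes V :: "nat set"
  assumes "system3 t V E \<F>"
  shows "card \<F> \<in> {card \<F> | (V' :: nat set) E \<F>. system3 t V' E \<F> \<and> card V' = card V}"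
  unfolding mem_Collect_eq
  by (rule exI[of _ V], rule exI[of _ E], rule exI[of _ \<F>]) (simp add: assms)

lemma s3_attained:
  obtains V :: "nat set" and E \<F> where "system3 t V E \<F>" "card V = m" "card \<F> = s3 t m"
proof -
  have "\<not> clique T {}" if "card T = 3" for T :: "nat set"
  proof -
    obtain x y z where "T = {x, y, z}" "x \<noteq> y"
      using \<open>card T = 3\<close> unfolding card_3_iff by blast
    then show ?thesis unfolding clique_def by blast
  qed
  then have "system3 t {..<m} {} {}"
    by (simp add: system3_def fin_sgraph_def triangle_free_def nsets_def)
  from card_in_s3_set[OF this]
  have "{card \<F> | (V :: nat set) E \<F>. system3 t V E \<F> \<and> card V = m} \<noteq> {}"
    unfolding card_lessThan by (metis empty_iff)
  from Max_in[OF finite_s3_set this]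
  have "\<exists>(V :: nat set) E \<F>. s3 t m = card \<F> \<and> system3 t V E \<F> \<and> card V = m"
    unfolding s3_def[symmetric] by (rule CollectD)
  then obtain V :: "nat set" and E \<F> where "s3 t m = card \<F>" "system3 t V E \<F>" "card V = m"
    by (elim exE conjE)
  then show thesis by (intro that) simp_all
qed

lemma system3_image:
  assumes s: "system3 t V E \<F>" and inj: "inj_on f V"
  shows "system3 t (f ` V) ((`) f ` E) ((`) f ` \<F>)"
proof -
  have fin: "finite V" and E: "E \<subseteq> [V]\<^bsup>2\<^esup>" and tf: "\<And>T. T \<in> [V]\<^bsup>3\<^esup> \<Longrightarrow> \<not> clique T E"
    using s by (auto simp: system3_def fin_sgraph_def triangle_free_def)
  have edge: "{f u, f v} \<in> (`) f ` E \<longleftrightarrow> {u, v} \<in> E" if "u \<in> V" "v \<in> V" for u v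
  proof
    assume "{f u, f v} \<in> (`) f ` E"
    then obtain e where e: "e \<in> E" "f ` {u, v} = f ` e" by auto
    moreover have "e \<subseteq> V" using e E by (auto simp: nsets_def)
    ultimately have "{u, v} = e" using inj_on_image_eq_iff[OF inj, of "{u, v}" e] that by auto
    with e show "{u, v} \<in> E" by simp
  qed (metis image_eqI image_empty image_insert)
  have "f ` e \<in> [f ` V]\<^bsup>2\<^esup>" if "e \<in> E" for e
  proof -
    have "e \<subseteq> V" "finite e" "card e = 2" using E that by (auto simp: nsets_def)
    then show ?thesis using card_image[OF inj_on_subset[OF inj]] by (auto simp: nsets_def)
  qed
  then have "fin_sgraph (f ` V) ((`) f ` E)"
    using fin by (auto simp: fin_sgraph_def)
  moreover have "\<not> clique T ((`) f ` E)" if "T \<in> [f ` V]\<^bsup>3\<^esup>" for T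
  proof
    assume cl: "clique T ((`) f ` E)"
    have "T \<subseteq> f ` V" using that by (simp add: nsets_def)
    then obtain U where U: "U \<subseteq> V" "T = f ` U" by (rule subset_imageE)
    then have "card U = 3"
      using that card_image[OF inj_on_subset[OF inj U(1)]] by (simp add: nsets_def)
    moreover have "finite U" using U(1) fin by (rule finite_subset)
    ultimately have "U \<in> [V]\<^bsup>3\<^esup>" using U by (simp add: nsets_def)
    moreover have "{u, v} \<in> E" if "u \<in> U" "v \<in> U" "u \<noteq> v" for u v
    proof -
      have uv: "u \<in> V" "v \<in> V" using that U by auto
      moreover have "f u \<noteq> f v" using inj uv that by (auto dest: inj_onD)
      ultimately show ?thesis using cl that U edge unfolding clique_def by blast
    qed
    then have "clique U E" by (simp add: clique_def)
    ultimately show False using tf by blast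
  qed
  moreover have "card (f ` S) = t \<and> maximal_indep (f ` V) ((`) f ` E) (f ` S)" if "S \<in> \<F>" for S
  proof -
    have S: "card S = t" "S \<subseteq> V" "indep S E" "\<And>v. v \<in> V - S \<Longrightarrow> \<exists>u \<in> S. {u, v} \<in> E"
      using s that by (auto simp: system3_def maximal_indep_def)
    have "card (f ` S) = t" using S card_image[OF inj_on_subset[OF inj]] by auto
    moreover have "indep (f ` S) ((`) f ` E)"
      unfolding indep_def
    proof (intro ballI impI)
      fix x y assume "x \<in> f ` S" "y \<in> f ` S" "x \<noteq> y"
      then obtain u v where "x = f u" "y = f v" "u \<in> S" "v \<in> S" "u \<noteq> v" by auto
      moreover from this have "{u, v} \<notin> E" "u \<in> V" "v \<in> V"
        using S(2,3) by (auto simp: indep_def)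
      ultimately show "{x, y} \<notin> (`) f ` E" by (simp only: edge not_False_eq_True)
    qed
    moreover have "\<exists>u \<in> f ` S. {u, x} \<in> (`) f ` E" if x: "x \<in> f ` V - f ` S" for x
    proof -
      obtain v where v: "x = f v" "v \<in> V - S" using x by blast
      with S(4) obtain u where "u \<in> S" "{u, v} \<in> E" by blast
      then show ?thesis using v S(2) edge[of u v] by auto
    qed
    ultimately show ?thesis using S by (auto simp: maximal_indep_def)
  qed
  moreover have "f ` S \<inter> f ` T \<noteq> {}" if "S \<in> \<F>" "T \<in> \<F>" "f ` S \<noteq> f ` T" for S T
  proof -
    have "S \<noteq> T" using that by blast
    then have "S \<inter> T \<noteq> {}" using s that unfolding system3_def by blast
    then show ?thesis by auto
  qed
  ultimately show ?thesis
    unfolding system3_def triangle_free_def by simp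
qed

lemma card_le_s3:
  fixes V :: "'a set"
  assumes s: "system3 t V E \<F>"
  shows "card \<F> \<le> s3 t (card V)"
proof -
  have "finite V" using s by (simp add: system3_def fin_sgraph_def)
  then obtain f :: "'a \<Rightarrow> nat" where inj: "inj_on f V"
    by (auto dest: finite_imp_inj_to_nat_seg)
  have "inj_on ((`) f) \<F>"
    using inj_on_image_Pow[OF inj] system3_subset_Pow[OF s] inj_on_subset by blast
  then have "card ((`) f ` \<F>) = card \<F>" by (rule card_image)
  moreover have "card (f ` V) = card V" using inj by (rule card_image)
  moreover have "card ((`) f ` \<F>) \<le> s3 t (card (f ` V))"
    unfolding s3_def
    by (rule Max_ge[OF finite_s3_set card_in_s3_set[OF system3_image[OF s inj]]])
  ultimately show ?thesis by simp
qed

end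

theory Submission
  imports Defs
begin

text \<open>
  Adding an isolated vertex to the graph and to every member of the family gives the lower bound.
  For the upper bound, fix a member \<open>S\<^sub>0\<close>. Every member meets \<open>S\<^sub>0\<close>, so it contains some
  \<open>v \<in> S\<^sub>0\<close> and a further vertex \<open>u \<noteq> v\<close>, with at most \<open>(t + 1) m\<close> choices for \<open>(v, u)\<close>.
  The members containing \<open>v\<close> and \<open>u\<close>, with \<open>v\<close> deleted, form a \<open>(3,t)\<close>-system on the
  non-neighbours of \<open>v\<close>: they all share \<open>u\<close>. This graph may have fewer than \<open>m\<close> vertices, but
  \<open>s\<^bsub>3,t\<^esub>\<close> is monotone, since a new vertex may be joined to all vertices of one fixed member:
  that member is independent and meets all the others.
\<close>

section \<open>Edges and triangles in terms of vertices\<close>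

lemma fin_sgraph_edgeD:
  assumes "fin_sgraph V E" "{x, y} \<in> E"
  shows "x \<in> V" "y \<in> V" "x \<noteq> y"
proof -
  have "{x, y} \<subseteq> V" "card {x, y} = 2"
    using assms by (auto simp: fin_sgraph_def nsets_def)
  then show "x \<in> V" "y \<in> V" "x \<noteq> y" by auto
qed

text \<open>Edges have two distinct ends, so three such edges already force \<open>x\<close>,
  \<open>y\<close>, \<open>z\<close> to be distinct. The right-hand side mentions only
  \<open>E\<close>, so the property carries over when the vertex set changes.\<close>

lemma triangle_free_iff:
  assumes "fin_sgraph V E"
  shows "triangle_free V E \<longleftrightarrow> (\<forall>x y z. \<not> ({x, y} \<in> E \<and> {y, z} \<in> E \<and> {x, z} \<in> E))"
proof
  assume tf: "triangle_free V E"
  show "\<forall>x y z. \<not> ({x, y} \<in> E \<and> {y, z} \<in> E \<and> {x, z} \<in> E)"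
  proof (intro allI notI)
    fix x y z assume *: "{x, y} \<in> E \<and> {y, z} \<in> E \<and> {x, z} \<in> E"
    then have V: "x \<in> V" "y \<in> V" "z \<in> V" "x \<noteq> y" "y \<noteq> z" "x \<noteq> z"
      using fin_sgraph_edgeD[OF assms] by blast+
    then have "{x, y, z} \<in> [V]\<^bsup>3\<^esup>" by (simp add: nsets_def)
    moreover have "clique {x, y, z} E"
      using * by (auto simp: clique_def insert_commute)
    ultimately show False using tf by (auto simp: triangle_free_def)
  qed
next
  assume none: "\<forall>x y z. \<not> ({x, y} \<in> E \<and> {y, z} \<in> E \<and> {x, z} \<in> E)"
  show "triangle_free V E"
    unfolding triangle_free_def
  proof (intro ballI notI)
    fix T assume "T \<in> [V]\<^bsup>3\<^esup>" and cl: "clique T E"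
    then have "card T = 3" by (simp add: nsets_def)
    then obtain x y z where "T = {x, y, z}" "x \<noteq> y" "y \<noteq> z" "x \<noteq> z"
      unfolding card_3_iff by blast
    then have "{x, y} \<in> E" "{y, z} \<in> E" "{x, z} \<in> E"
      using cl by (auto simp: clique_def)
    then show False using none by blast
  qed
qed

section \<open>Adding one vertex to a system\<close>

text \<open>The new vertex lies on no edge, so it does not disturb independence. It belongs to every
  new member, so it needs no neighbour there and makes any two members meet.\<close>

lemma system3_insert_isolated:
  assumes s: "system3 t V E \<F>" and w: "w \<notin> V"
  shows "system3 (Suc t) (insert w V) E (insert w ` \<F>)"
proof -
  have g: "fin_sgraph V E" and fin: "finite V"
    using s by (auto simp: system3_def fin_sgraph_def)
  have g': "fin_sgraph (insert w V) E"
    using g nsets_mono[of V "insert w V" 2] by (auto simp: fin_sgraph_def)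
  have "triangle_free (insert w V) E"
    using s triangle_free_iff[OF g] triangle_free_iff[OF g'] by (simp add: system3_def)
  moreover have "card (insert w S) = Suc t \<and> maximal_indep (insert w V) E (insert w S)"
    if "S \<in> \<F>" for S
  proof -
    have S: "card S = t" "S \<subseteq> V" "indep S E" "\<forall>v \<in> V - S. \<exists>u \<in> S. {u, v} \<in> E"
      using s that by (auto simp: system3_def maximal_indep_def)
    have "{w, x} \<notin> E" "{x, w} \<notin> E" for x
      using fin_sgraph_edgeD[OF g] w by blast+
    then have "indep (insert w S) E" using S(3) by (auto simp: indep_def)
    moreover have "finite S" "w \<notin> S" using S(2) fin w by (auto intro: finite_subset)
    ultimately show ?thesis using S by (auto simp: maximal_indep_def)
  qed
  ultimately show ?thesis
    using g' by (auto simp: system3_def)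
qed

text \<open>The family stays as it is: \<open>w\<close> lies outside every member, and its edges to
  \<open>S0\<close> give it a neighbour in each of them. A triangle through \<open>w\<close> would
  need an edge inside \<open>S0\<close>.\<close>

lemma system3_insert_joined:
  assumes s: "system3 t V E \<F>" and w: "w \<notin> V" and S0: "S0 \<in> \<F>" and t: "t \<ge> 1"
  shows "system3 t (insert w V) (E \<union> (\<lambda>x. {x, w}) ` S0) \<F>"
proof -
  let ?E = "E \<union> (\<lambda>x. {x, w}) ` S0"
  have g: "fin_sgraph V E" and fin: "finite V"
    using s by (auto simp: system3_def fin_sgraph_def)
  have tf: "\<not> ({x, y} \<in> E \<and> {y, z} \<in> E \<and> {x, z} \<in> E)" for x y z
    using s triangle_free_iff[OF g] by (simp add: system3_def)
  have S0V: "S0 \<subseteq> V" and ind: "indep S0 E"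
    using s S0 by (auto simp: system3_def maximal_indep_def)
  \<comment> \<open>The system condition speaks of distinct members only; \<open>S0\<close> meets
    itself because \<open>t \<ge> 1\<close> makes it nonempty.\<close>
  have meets: "S \<inter> S0 \<noteq> {}" if "S \<in> \<F>" for S
  proof (cases "S = S0")
    case True
    then show ?thesis using s S0 t by (auto simp: system3_def)
  next
    case False
    then show ?thesis using s S0 that by (auto simp: system3_def)
  qed
  have old: "{x, y} \<in> ?E \<longleftrightarrow> {x, y} \<in> E" if "x \<noteq> w" "y \<noteq> w" for x y
    using that by (auto simp: doubleton_eq_iff)
  have new: "{x, w} \<in> ?E \<longleftrightarrow> x \<in> S0" for x
    using fin_sgraph_edgeD[OF g, of x w] w S0V by (auto simp: doubleton_eq_iff)
  have g': "fin_sgraph (insert w V) ?E"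
  proof -
    have "{x, w} \<in> [insert w V]\<^bsup>2\<^esup>" if "x \<in> S0" for x
      using that S0V w by (auto simp: nsets_def card_insert_if)
    then have "(\<lambda>x. {x, w}) ` S0 \<subseteq> [insert w V]\<^bsup>2\<^esup>" by (rule image_subsetI)
    moreover have "E \<subseteq> [insert w V]\<^bsup>2\<^esup>"
      using g nsets_mono[OF subset_insertI, of V 2 w]
      unfolding fin_sgraph_def by (blast intro: subset_trans)
    ultimately show ?thesis using fin by (simp add: fin_sgraph_def)
  qed
  \<comment> \<open>\<open>indep\<close> covers distinct vertices; the case \<open>x = y\<close> is
    excluded since edges are not singletons.\<close>
  have S0E: "{x, y} \<notin> E" if "x \<in> S0" "y \<in> S0" for x y
    using ind that fin_sgraph_edgeD(3)[OF g, of x y] by (auto simp: indep_def)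
  have "\<not> ({x, y} \<in> ?E \<and> {y, z} \<in> ?E \<and> {x, z} \<in> ?E)" for x y z
  proof
    assume *: "{x, y} \<in> ?E \<and> {y, z} \<in> ?E \<and> {x, z} \<in> ?E"
    then have ne: "x \<noteq> y" "y \<noteq> z" "x \<noteq> z"
      by (simp_all only: fin_sgraph_edgeD(3)[OF g'] not_False_eq_True)
    have sym: "{y, x} \<in> ?E" "{z, y} \<in> ?E" "{z, x} \<in> ?E"
      using * by (simp_all add: insert_commute)
    \<comment> \<open>If one corner is \<open>w\<close>, the other two are adjacent vertices of
      \<open>S0\<close>; otherwise all three edges are old.\<close>
    consider "x = w" | "y = w" | "z = w" | "x \<noteq> w" "y \<noteq> w" "z \<noteq> w" by blast
    then show False
    proof cases
      case 1
      then have "y \<in> S0" "z \<in> S0" using sym new by metis+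
      moreover have "{y, z} \<in> E" using * old[of y z] 1 ne by simp
      ultimately show False using S0E by blast
    next
      case 2
      then have "x \<in> S0" "z \<in> S0" using sym * new by metis+
      moreover have "{x, z} \<in> E" using * old[of x z] 2 ne by simp
      ultimately show False using S0E by blast
    next
      case 3
      then have "x \<in> S0" "y \<in> S0" using * new by metis+
      moreover have "{x, y} \<in> E" using * old[of x y] 3 ne by simp
      ultimately show False using S0E by blast
    next
      case 4
      then show False using * old tf by metis
    qed
  qed
  then have "triangle_free (insert w V) ?E"
    using triangle_free_iff[OF g'] by blast
  moreover have "card S = t \<and> maximal_indep (insert w V) ?E S" if "S \<in> \<F>" for S
  proof -
    have S: "card S = t" "S \<subseteq> V" "indep S E" "\<forall>v \<in> V - S. \<exists>u \<in> S. {u, v} \<in> E"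
      using s that by (auto simp: system3_def maximal_indep_def)
    have "w \<notin> S" using S(2) w by blast
    then have "indep S ?E" using S(3) old unfolding indep_def by metis
    moreover have "\<exists>u \<in> S. {u, w} \<in> ?E" using meets[OF that] new by blast
    ultimately show ?thesis using S by (auto simp: maximal_indep_def)
  qed
  ultimately show ?thesis
    using g' s by (simp add: system3_def)
qed

section \<open>Lower bound and monotonicity\<close>

lemma s3_Suc_Suc: "s3 t m \<le> s3 (Suc t) (Suc m)"
proof -
  obtain V :: "nat set" and E \<F> where s: "system3 t V E \<F>" "card V = m" "card \<F> = s3 t m"
    by (rule s3_attained)
  then have fin: "finite V" by (simp add: system3_def fin_sgraph_def)
  then obtain w where w: "w \<notin> V" using ex_new_if_finite infinite_UNIV_nat by blast
  have "inj_on (insert w) \<F>"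
    using system3_subset_Pow[OF s(1)] w by (intro inj_onI) (metis PowD insert_ident subsetD)
  then have "s3 t m = card (insert w ` \<F>)" using s(3) by (simp add: card_image)
  also have "\<dots> \<le> s3 (Suc t) (card (insert w V))"
    by (rule card_le_s3[OF system3_insert_isolated[OF s(1) w]])
  finally show ?thesis using s(2) fin w by simp
qed

lemma s3_le_Suc:
  assumes "t \<ge> 1"
  shows "s3 t m \<le> s3 t (Suc m)"
proof -
  obtain V :: "nat set" and E \<F> where s: "system3 t V E \<F>" "card V = m" "card \<F> = s3 t m"
    by (rule s3_attained)
  then have fin: "finite V" by (simp add: system3_def fin_sgraph_def)
  then obtain w where w: "w \<notin> V" using ex_new_if_finite infinite_UNIV_nat by blast
  show ?thesis
  \<comment> \<open>An empty family offers no \<open>S0\<close> to join to, but then the left-hand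
    side is 0.\<close>
  proof (cases "\<F> = {}")
    case True
    then show ?thesis using s(3) by simp
  next
    case False
    then obtain S0 where "S0 \<in> \<F>" by blast
    from card_le_s3[OF system3_insert_joined[OF s(1) w this assms]]
    show ?thesis using s fin w by simp
  qed
qed

lemma s3_mono: "t \<ge> 1 \<Longrightarrow> m \<le> n \<Longrightarrow> s3 t m \<le> s3 t n"
  by (rule lift_Suc_mono_le[of "s3 t"]) (rule s3_le_Suc)

section \<open>Links of vertices and the upper bound\<close>

text \<open>Independence of \<open>S\<close> keeps \<open>S - {v}\<close> inside \<open>W\<close>. A
  vertex of \<open>W\<close> is not adjacent to \<open>v\<close>, so whatever neighbour it has in
  \<open>S\<close> survives the deletion of \<open>v\<close>.\<close>

lemma system3_link:
  assumes s: "system3 (Suc t) V E \<F>" and uv: "u \<noteq> v"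
  defines "W \<equiv> {w \<in> V. w \<noteq> v \<and> {v, w} \<notin> E}"
  shows "system3 t W (E \<inter> Pow W) ((\<lambda>S. S - {v}) ` {S \<in> \<F>. v \<in> S \<and> u \<in> S})"
proof -
  let ?E = "E \<inter> Pow W"
  have g: "fin_sgraph V E" and fin: "finite V"
    using s by (auto simp: system3_def fin_sgraph_def)
  have WV: "W \<subseteq> V" by (auto simp: W_def)
  have g': "fin_sgraph W ?E"
    using g finite_subset[OF WV fin] by (auto simp: fin_sgraph_def nsets_def)
  have "triangle_free V E" using s by (simp add: system3_def)
  then have "triangle_free W ?E"
    unfolding triangle_free_iff[OF g] triangle_free_iff[OF g'] Int_iff
    by (intro allI notI) (elim conjE, simp)
  moreover have "card (S - {v}) = t \<and> maximal_indep W ?E (S - {v})"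
    if "S \<in> \<F>" "v \<in> S" for S
  proof -
    have S: "card S = Suc t" "S \<subseteq> V" "indep S E" "\<And>v. v \<in> V - S \<Longrightarrow> \<exists>u \<in> S. {u, v} \<in> E"
      using s that by (auto simp: system3_def maximal_indep_def)
    have SW: "S - {v} \<subseteq> W" using S(2,3) \<open>v \<in> S\<close> by (auto simp: W_def indep_def)
    have "card (S - {v}) = t" using S(1) \<open>v \<in> S\<close> by (simp add: card_Diff_singleton)
    moreover have "indep (S - {v}) ?E" using S(3) by (auto simp: indep_def)
    moreover have "\<exists>x \<in> S - {v}. {x, y} \<in> ?E" if y: "y \<in> W - (S - {v})" for y
    proof -
      have "y \<in> V - S" "{v, y} \<notin> E" using y by (auto simp: W_def)
      with S(4) obtain x where "x \<in> S" "{x, y} \<in> E" "x \<noteq> v" by blast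
      then show ?thesis using SW y by blast
    qed
    ultimately show ?thesis using SW by (auto simp: maximal_indep_def)
  qed
  \<comment> \<open>Since \<open>u \<noteq> v\<close>, the vertex \<open>u\<close> remains in all
    shortened members. Sharing \<open>v\<close> alone would not ensure that they still meet.\<close>
  ultimately show ?thesis
    using g' uv by (auto simp: system3_def)
qed

text \<open>Deleting \<open>v\<close> is injective on sets that contain \<open>v\<close>, and the
  link omits \<open>v\<close> itself, so it has at most \<open>m\<close> vertices.\<close>

lemma card_pair_link_le:
  assumes s: "system3 (Suc t) V E \<F>" and t: "t \<ge> 1" and V: "card V = Suc m"
    and v: "v \<in> V" and uv: "u \<noteq> v"
  shows "card {S \<in> \<F>. v \<in> S \<and> u \<in> S} \<le> s3 t m"
proof -
  let ?W = "{w \<in> V. w \<noteq> v \<and> {v, w} \<notin> E}"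
  have fin: "finite V" using s by (simp add: system3_def fin_sgraph_def)
  have "card ?W \<le> card (V - {v})" using fin by (intro card_mono) auto
  then have W: "card ?W \<le> m" using V v by (simp add: card_Diff_singleton)
  have "inj_on (\<lambda>S. S - {v}) {S \<in> \<F>. v \<in> S \<and> u \<in> S}"
    by (rule inj_onI) blast
  then have "card {S \<in> \<F>. v \<in> S \<and> u \<in> S} = card ((\<lambda>S. S - {v}) ` {S \<in> \<F>. v \<in> S \<and> u \<in> S})"
    by (simp add: card_image)
  also have "\<dots> \<le> s3 t (card ?W)" by (rule card_le_s3[OF system3_link[OF s uv]])
  also have "\<dots> \<le> s3 t m" using t W by (rule s3_mono)
  finally show ?thesis .
qed

lemma s3_Suc_Suc_le:
  assumes t: "t \<ge> 1"
  shows "s3 (Suc t) (Suc m) \<le> Suc t * (m * s3 t m)"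
proof -
  obtain V :: "nat set" and E \<F>
    where s: "system3 (Suc t) V E \<F>" "card V = Suc m" "card \<F> = s3 (Suc t) (Suc m)"
    by (rule s3_attained)
  have fin: "finite V" using s(1) by (simp add: system3_def fin_sgraph_def)
  show ?thesis
  proof (cases "\<F> = {}")
    case True
    then show ?thesis using s(3) by simp
  next
    case False
    then obtain S0 where S0: "S0 \<in> \<F>" by blast
    have cardF: "card S = Suc t" "S \<subseteq> V" "finite S" if "S \<in> \<F>" for S
      using s(1) that fin by (auto simp: system3_def maximal_indep_def intro: finite_subset)
    \<comment> \<open>A cover suffices for the union bound; a member may be counted for several
      pairs.\<close>
    have "\<F> \<subseteq> (\<Union>v\<in>S0. \<Union>u\<in>V - {v}. {S \<in> \<F>. v \<in> S \<and> u \<in> S})"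
    proof
      fix S assume S: "S \<in> \<F>"
      have "S \<inter> S0 \<noteq> {}"
      proof (cases "S = S0")
        case True
        then show ?thesis using cardF[OF S0] by auto
      next
        case False
        then show ?thesis using s(1) S S0 by (simp add: system3_def)
      qed
      then obtain v where v: "v \<in> S" "v \<in> S0" by blast
      \<comment> \<open>Members have \<open>Suc t \<ge> 2\<close> elements, so a second vertex is
        available.\<close>
      have "card (S - {v}) \<noteq> 0" using cardF[OF S] v t by (simp add: card_Diff_singleton)
      then have "S - {v} \<noteq> {}" by (intro notI) simp
      then obtain u where "u \<in> S - {v}" by blast
      then show "S \<in> (\<Union>v\<in>S0. \<Union>u\<in>V - {v}. {S \<in> \<F>. v \<in> S \<and> u \<in> S})"
        using v S cardF(2)[OF S] by blast
    qed
    moreover have "finite (\<Union>v\<in>S0. \<Union>u\<in>V - {v}. {S \<in> \<F>. v \<in> S \<and> u \<in> S})"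
      using finite_subset[OF system3_subset_Pow[OF s(1)]] fin cardF(3)[OF S0]
      by (intro finite_UN_I) simp_all
    ultimately have "card \<F> \<le> card (\<Union>v\<in>S0. \<Union>u\<in>V - {v}. {S \<in> \<F>. v \<in> S \<and> u \<in> S})"
      by (intro card_mono)
    also have "\<dots> \<le> (\<Sum>v\<in>S0. card (\<Union>u\<in>V - {v}. {S \<in> \<F>. v \<in> S \<and> u \<in> S}))"
      by (rule card_UN_le[OF cardF(3)[OF S0]])
    also have "\<dots> \<le> (\<Sum>v\<in>S0. m * s3 t m)"
    proof (rule sum_mono)
      fix v assume "v \<in> S0"
      then have v: "v \<in> V" using cardF(2)[OF S0] by blast
      have "card (\<Union>u\<in>V - {v}. {S \<in> \<F>. v \<in> S \<and> u \<in> S})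
          \<le> (\<Sum>u\<in>V - {v}. card {S \<in> \<F>. v \<in> S \<and> u \<in> S})"
        using fin by (intro card_UN_le) simp
      also have "\<dots> \<le> (\<Sum>u\<in>V - {v}. s3 t m)"
        by (rule sum_mono) (use card_pair_link_le[OF s(1) t s(2) v] in blast)
      also have "\<dots> = m * s3 t m" using s(2) v by (simp add: card_Diff_singleton)
      finally show "card (\<Union>u\<in>V - {v}. {S \<in> \<F>. v \<in> S \<and> u \<in> S}) \<le> m * s3 t m" .
    qed
    also have "\<dots> = Suc t * (m * s3 t m)" using cardF(1)[OF S0] by simp
    finally show ?thesis using s(3) by simp
  qed
qed

theorem theorem12:
  fixes t :: nat
  assumes "t \<ge> 1"
  shows "(\<lambda>m. real (s3 t m)) \<in> O(\<lambda>m. real (s3 (t + 1) (m + 1))) \<and>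
         (\<lambda>m. real (s3 (t + 1) (m + 1))) \<in> O(\<lambda>m. real m * real (s3 t m))"
proof
  show "(\<lambda>m. real (s3 t m)) \<in> O(\<lambda>m. real (s3 (t + 1) (m + 1)))"
    using s3_Suc_Suc by (intro bigoI[where c = 1] always_eventually) simp
  \<comment> \<open>This includes \<open>m = 0\<close>, where both sides vanish: a single vertex has
    no subset of size \<open>t + 1 \<ge> 2\<close>.\<close>
  have "real (s3 (t + 1) (m + 1)) \<le> real (Suc t) * (real m * real (s3 t m))" for m
    using s3_Suc_Suc_le[OF assms, of m] unfolding of_nat_mult[symmetric] of_nat_le_iff by simp
  then show "(\<lambda>m. real (s3 (t + 1) (m + 1))) \<in> O(\<lambda>m. real m * real (s3 t m))"
    by (intro bigoI[where c = "real (Suc t)"] always_eventually) (simp add: abs_mult)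
qed

end
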